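(* Let $p,q>1$ satisfy $\frac1p+\frac1q\ge1$. The map $$\mathcal I_{p,q}:\mathcal E^p\times\mathcal E^q\to C([0,1]),\qquad \mathcal I_{p,q}(f,g):=I_{f,g},$$ is a (well-defined) bounded bilinear operator. More precisely, there exists a constant $C_{p,q}>0$ such that $$\|I_{f,g}\|_\infty\le C_{p,q}\|f\|_{\mathcal E^p}\|g\|_{\mathcal E^q},\qquad f\in\mathcal E^p,\ g\in\mathcal E^q.$$
   Context: $C([0,1])$ denotes the real-valued continuous functions on $[0,1]$, $\|\cdot\|_\infty$ the uniform norm. $\mathbb N_0=\{0,1,2,\dots\}$, $\mathbb N_{-1}=\{-1,0,1,\dots\}$. For $n\in\mathbb N_0$: $t_{n,k}=k2^{-n}$ for $0\le k\le 2^n$, $\mathbb T_n=\{t_{n,k}:0\le k\le 2^n\}$, $\mathbb T=\bigcup_{n\ge0}\mathbb T_n$, $I_n=\{0,\dots,2^n-1\}$; for $t\in\mathbb T$, $\ell(t)=\min\{m\ge0:t\in\mathbb T_m\}$. Dyadic left sums: for $f,g\in C([0,1])$, $t\in\mathbb T$, $n\ge\ell(t)$, $$S_n^L(t;f,g)=\sum_{k=0}^{2^nt-1}f(t_{n,k})\big(g(t_{n,k+1})-g(t_{n,k})\big)$$ (empty sum $=0$). The dyadic integral over $[0,t]$ exists if $(S_n^L(t;f,g))_{n\ge\ell(t)}$ converges, and its limit is denoted $I^{\mathbb T}_{f,g}(t)$. Faber--Schauder integral: if $I^{\mathbb T}_{f,g}(t)$ exists for every $t\in\mathbb T$ and the map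 $I^{\mathbb T}_{f,g}:\mathbb T\to\mathbb R$ admits a (necessarily unique) continuous extension to $[0,1]$, this extension is denoted $I_{f,g}:[0,1]\to\mathbb R$ and one says that the Faber--Schauder integral $I_{f,g}$ exists on $[0,1]$. Faber--Schauder coefficients of $f\in C([0,1])$: $\theta^f_{-1,0}=f(1)-f(0)$, and for $n\ge0$, $k\in I_n$, $\theta^f_{n,k}=2^{n/2}\big(2f(t_{n+1,2k+1})-f(t_{n,k})-f(t_{n,k+1})\big)$. Level energies ($p>1$): $\zeta_f^{(p)}(-1)=2^{1-\frac1p}|\theta^f_{-1,0}|$ and $\zeta_f^{(p)}(n)=\big(2^{-np/2}\sum_{k\in I_n}|\theta^f_{n,k}|^p\big)^{1/p}$ for $n\ge0$. Schauder tail sequence: $H_f(n)=\sum_{m=n}^\infty 2^{-m/2}\sup_{k\in I_m}|\theta^f_{m,k}|\in[0,\infty]$ for $n\ge0$. Energy space ($p>1$): $\|f\|_{\mathcal E^p}=\|f\|_\infty+\|\zeta_f^{(p)}\|_{\ell^p(\mathbb N_{-1})}+\|H_f\|_{\ell^p(\mathbb N_0)}$ and $\mathcal E^p=\{f\in C([0,1]):\|f\|_{\mathcal E^p}<\infty\}$. *)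

theory Defs
  imports "HOL-Analysis.Analysis"
begin

text \<open>
  An element of \<open>C([0,1])\<close> is represented by a function on \<^typ>\<open>real\<close> that is continuous on
  \<open>{0..1}\<close>. Its values outside \<open>{0..1}\<close> are irrelevant: every notion below only evaluates
  functions on \<open>{0..1}\<close> (see \<open>FS_integral_cong\<close> and \<open>energy_norm_cong\<close>).
\<close>

definition C01 :: "(real \<Rightarrow> real) set" where
  "C01 = {f. continuous_on {0..1} f}"

definition sup_norm :: "(real \<Rightarrow> real) \<Rightarrow> ennreal" where
  "sup_norm f = (SUP x\<in>{0..1}. ennreal \<bar>f x\<bar>)"

section \<open>Dyadic points and the Faber--Schauder integral\<close>

definition dyad :: "nat \<Rightarrow> nat \<Rightarrow> real" where
  "dyad n k = real k / 2 ^ n"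

definition dyadic_grid :: "nat \<Rightarrow> real set" where
  "dyadic_grid n = dyad n ` {0..2 ^ n}"

definition dyadic_points :: "real set" where
  "dyadic_points = (\<Union>n. dyadic_grid n)"

definition level :: "real \<Rightarrow> nat" where
  "level t = (LEAST m. t \<in> dyadic_grid m)"

text \<open>
  For \<open>t \<in> dyadic_points\<close> and \<open>n \<ge> level t\<close> the number \<open>2 ^ n * t\<close> is a natural number, so that
  the floor below is exact; the sums are only used for such \<open>n\<close>.
\<close>

definition left_sum :: "nat \<Rightarrow> real \<Rightarrow> (real \<Rightarrow> real) \<Rightarrow> (real \<Rightarrow> real) \<Rightarrow> real" where
  "left_sum n t f g =
     (\<Sum>k<nat \<lfloor>2 ^ n * t\<rfloor>. f (dyad n k) * (g (dyad n (k + 1)) - g (dyad n k)))"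

text \<open>The sequence \<open>(left_sum n t f g)\<close>, \<open>n \<ge> level t\<close>, is reindexed by \<open>n = level t + i\<close>.\<close>

definition dyadic_integral_exists :: "(real \<Rightarrow> real) \<Rightarrow> (real \<Rightarrow> real) \<Rightarrow> real \<Rightarrow> bool" where
  "dyadic_integral_exists f g t \<longleftrightarrow> convergent (\<lambda>i. left_sum (level t + i) t f g)"

definition dyadic_integral :: "(real \<Rightarrow> real) \<Rightarrow> (real \<Rightarrow> real) \<Rightarrow> real \<Rightarrow> real" where
  "dyadic_integral f g t = lim (\<lambda>i. left_sum (level t + i) t f g)"

definition is_FS_integral :: "(real \<Rightarrow> real) \<Rightarrow> (real \<Rightarrow> real) \<Rightarrow> (real \<Rightarrow> real) \<Rightarrow> bool" where
  "is_FS_integral f g J \<longleftrightarrow>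
     (\<forall>t\<in>dyadic_points. dyadic_integral_exists f g t) \<and>
     J \<in> C01 \<and> (\<forall>t\<in>dyadic_points. J t = dyadic_integral f g t)"

definition FS_integral_exists :: "(real \<Rightarrow> real) \<Rightarrow> (real \<Rightarrow> real) \<Rightarrow> bool" where
  "FS_integral_exists f g \<longleftrightarrow> (\<exists>J. is_FS_integral f g J)"

text \<open>
  \<open>extensional\<close> pins down the irrelevant values outside \<open>{0..1}\<close>, so that the description is
  unique (see \<open>is_FS_integral_FS_integral\<close>).
\<close>

definition FS_integral :: "(real \<Rightarrow> real) \<Rightarrow> (real \<Rightarrow> real) \<Rightarrow> real \<Rightarrow> real" where
  "FS_integral f g = (THE J. is_FS_integral f g J \<and> J \<in> extensional {0..1})"

section \<open>Energy spaces\<close>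

text \<open>The level index is an integer \<open>\<ge> -1\<close>; at level \<open>-1\<close> only \<open>k = 0\<close> is used.\<close>

definition FS_coeff :: "(real \<Rightarrow> real) \<Rightarrow> int \<Rightarrow> nat \<Rightarrow> real" where
  "FS_coeff f n k =
     (if n = -1 then f 1 - f 0
      else 2 powr (n / 2) *
        (2 * f (dyad (nat n + 1) (2 * k + 1)) - f (dyad (nat n) k) - f (dyad (nat n) (k + 1))))"

definition level_energy :: "real \<Rightarrow> (real \<Rightarrow> real) \<Rightarrow> int \<Rightarrow> real" where
  "level_energy p f n =
     (if n = -1 then 2 powr (1 - 1 / p) * \<bar>FS_coeff f (-1) 0\<bar>
      else (2 powr (- n * p / 2) * (\<Sum>k<2 ^ nat n. \<bar>FS_coeff f n k\<bar> powr p)) powr (1 / p))"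

definition tail_seq :: "(real \<Rightarrow> real) \<Rightarrow> nat \<Rightarrow> ennreal" where
  "tail_seq f n =
     (\<Sum>\<^sub>\<infinity>m\<in>{n..}. ennreal (2 powr (- real m / 2) * (SUP k\<in>{..<2 ^ m}. \<bar>FS_coeff f (int m) k\<bar>)))"

text \<open>Power \<open>x ^ r\<close> on \<open>[0,\<infinity>]\<close> for real \<open>r > 0\<close>.\<close>

definition ennreal_powr :: "ennreal \<Rightarrow> real \<Rightarrow> ennreal" where
  "ennreal_powr x r = (if x = \<infinity> then \<infinity> else ennreal (enn2real x powr r))"

definition lp_norm :: "real \<Rightarrow> 'i set \<Rightarrow> ('i \<Rightarrow> ennreal) \<Rightarrow> ennreal" where
  "lp_norm p A a = ennreal_powr (\<Sum>\<^sub>\<infinity>i\<in>A. ennreal_powr (a i) p) (1 / p)"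

definition energy_norm :: "real \<Rightarrow> (real \<Rightarrow> real) \<Rightarrow> ennreal" where
  "energy_norm p f =
     sup_norm f + lp_norm p {-1..} (\<lambda>n. ennreal (level_energy p f n)) + lp_norm p UNIV (tail_seq f)"

definition energy_space :: "real \<Rightarrow> (real \<Rightarrow> real) set" where
  "energy_space p = {f \<in> C01. energy_norm p f < \<infinity>}"

section \<open>Well-definedness\<close>

lemma dyad_in_unit: "k \<le> 2 ^ n \<Longrightarrow> dyad n k \<in> {0..1}"
proof -
  assume "k \<le> 2 ^ n"
  then have "real k \<le> real (2 ^ n)" by (simp only: of_nat_le_iff)
  then show ?thesis by (simp add: dyad_def)
qed

lemma dyadic_points_subset: "dyadic_points \<subseteq> {0..1}"
  unfolding dyadic_points_def dyadic_grid_def using dyad_in_unit by fastforce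

lemma closure_dyadic_points: "closure dyadic_points = {0..1}"
proof -
  have "dyadic_points = {0..1} \<inter> (\<Union>k m. {of_nat m / 2 ^ k})"
  proof (intro equalityI subsetI)
    fix x :: real assume "x \<in> dyadic_points"
    then show "x \<in> {0..1} \<inter> (\<Union>k m. {of_nat m / 2 ^ k})"
      using dyadic_points_subset by (auto simp: dyadic_points_def dyadic_grid_def dyad_def)
  next
    fix x :: real assume "x \<in> {0..1} \<inter> (\<Union>k m. {of_nat m / 2 ^ k})"
    then obtain k m where x: "x = real m / 2 ^ k" "x \<le> 1" by auto
    then have "real m \<le> real (2 ^ k)" by (simp add: divide_le_eq)
    then have "m \<le> 2 ^ k" by (simp only: of_nat_le_iff)
    then show "x \<in> dyadic_points"
      using x(1) unfolding dyadic_points_def dyadic_grid_def dyad_def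
      by (intro UN_I[of k] image_eqI[of _ _ m]) auto
  qed
  then show ?thesis
    using closure_dyadic_rationals_in_convex_set_pos_1[of "{0..1}"] by simp
qed

lemma is_FS_integral_unique:
  assumes "is_FS_integral f g J" "is_FS_integral f g K" "x \<in> {0..1}"
  shows "J x = K x"
proof -
  have "continuous_on (closure dyadic_points) (\<lambda>x. J x - K x)"
    using assms by (auto simp: closure_dyadic_points is_FS_integral_def C01_def intro: continuous_on_diff)
  then have "J x - K x = 0"
    by (rule continuous_constant_on_closure)
      (use assms in \<open>auto simp: closure_dyadic_points is_FS_integral_def\<close>)
  then show ?thesis by simp
qed

lemma is_FS_integral_FS_integral:
  assumes "FS_integral_exists f g"
  shows "is_FS_integral f g (FS_integral f g)"
proof -
  obtain J where J: "is_FS_integral f g J"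
    using assms by (auto simp: FS_integral_exists_def)
  have "continuous_on {0..1} (restrict J {0..1}) = continuous_on {0..1} J"
    by (rule continuous_on_cong) auto
  moreover have "restrict J {0..1} t = J t" if "t \<in> dyadic_points" for t
    using that dyadic_points_subset by (simp add: subset_iff)
  ultimately have K: "is_FS_integral f g (restrict J {0..1})"
    using J by (simp add: is_FS_integral_def C01_def del: restrict_apply)
  have "\<exists>!J. is_FS_integral f g J \<and> J \<in> extensional {0..1}"
  proof (rule ex1I)
    show "is_FS_integral f g (restrict J {0..1}) \<and> restrict J {0..1} \<in> extensional {0..1}"
      using K by simp
    fix L assume "is_FS_integral f g L \<and> L \<in> extensional {0..1}"
    then show "L = restrict J {0..1}"
      using is_FS_integral_unique[OF _ K, of L] by (intro extensionalityI[of _ "{0..1}"]) auto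
  qed
  from theI'[OF this] show ?thesis
    unfolding FS_integral_def by (rule conjunct1)
qed

lemma left_sum_cong:
  assumes "\<And>x. x \<in> {0..1} \<Longrightarrow> f x = f' x" "\<And>x. x \<in> {0..1} \<Longrightarrow> g x = g' x" "t \<le> 1"
  shows "left_sum n t f g = left_sum n t f' g'"
  unfolding left_sum_def
proof (rule sum.cong)
  fix k assume "k \<in> {..<nat \<lfloor>2 ^ n * t\<rfloor>}"
  moreover have "\<lfloor>2 ^ n * t\<rfloor> \<le> 2 ^ n"
  proof -
    have "2 ^ n * t \<le> 2 ^ n * 1"
      using assms(3) by (intro mult_left_mono) auto
    then have "\<lfloor>2 ^ n * t\<rfloor> \<le> \<lfloor>real_of_int (2 ^ n)\<rfloor>"
      by (intro floor_mono) simp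
    then show ?thesis by (simp only: floor_of_int)
  qed
  ultimately have "int (k + 1) \<le> int (2 ^ n)"
    by (simp add: zless_nat_eq_int_zless)
  then have "k + 1 \<le> 2 ^ n"
    by (simp only: of_nat_le_iff)
  then have "dyad n k \<in> {0..1}" "dyad n (k + 1) \<in> {0..1}"
    by (auto intro!: dyad_in_unit simp del: atLeastAtMost_iff)
  then show "f (dyad n k) * (g (dyad n (k + 1)) - g (dyad n k)) =
             f' (dyad n k) * (g' (dyad n (k + 1)) - g' (dyad n k))"
    using assms by simp
qed simp

lemma FS_integral_cong:
  assumes "\<And>x. x \<in> {0..1} \<Longrightarrow> f x = f' x" "\<And>x. x \<in> {0..1} \<Longrightarrow> g x = g' x"
  shows "FS_integral_exists f g = FS_integral_exists f' g'" "FS_integral f g = FS_integral f' g'"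
proof -
  have "t \<le> 1" if "t \<in> dyadic_points" for t
    using that dyadic_points_subset by auto
  then have "is_FS_integral f g = is_FS_integral f' g'"
    using left_sum_cong[of f f' g g'] assms
    by (auto simp: fun_eq_iff is_FS_integral_def dyadic_integral_exists_def dyadic_integral_def)
  then show "FS_integral_exists f g = FS_integral_exists f' g'" "FS_integral f g = FS_integral f' g'"
    by (simp_all add: FS_integral_exists_def FS_integral_def)
qed

lemma FS_coeff_cong:
  assumes "\<And>x. x \<in> {0..1} \<Longrightarrow> f x = f' x" "k < 2 ^ nat n"
  shows "FS_coeff f n k = FS_coeff f' n k"
proof -
  have "2 * k + 1 \<le> 2 ^ (nat n + 1)" using assms(2) by simp
  then have "dyad (nat n + 1) (2 * k + 1) \<in> {0..1}" "dyad (nat n) k \<in> {0..1}"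
    "dyad (nat n) (k + 1) \<in> {0..1}"
    using assms(2) by (auto intro!: dyad_in_unit simp del: atLeastAtMost_iff)
  then show ?thesis using assms(1) by (simp add: FS_coeff_def)
qed

lemma energy_norm_cong:
  assumes "\<And>x. x \<in> {0..1} \<Longrightarrow> f x = f' x"
  shows "energy_norm p f = energy_norm p f'"
proof -
  have "level_energy p f n = level_energy p f' n" for n
    using FS_coeff_cong[OF assms] by (simp add: level_energy_def)
  moreover have "tail_seq f = tail_seq f'"
    using FS_coeff_cong[OF assms] by (simp add: tail_seq_def fun_eq_iff)
  moreover have "sup_norm f = sup_norm f'"
    using assms by (simp add: sup_norm_def)
  ultimately show ?thesis by (simp add: energy_norm_def)
qed

end

theory Submission
  imports Defs
begin

text \<open>
  The idea is to stop the left sums at an arbitrary time \<open>t \<in> {0..1}\<close>, replacing \<open>g\<close> by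
  \<open>\<lambda>x. g (min t x)\<close>. The stopped sums are continuous in \<open>t\<close> and agree with the dyadic left sums at
  dyadic \<open>t\<close> once the level is fine enough. So it is enough that they converge uniformly in \<open>t\<close>,
  with a bound: the limit is then the Faber--Schauder integral.

  Refining level \<open>n\<close> to level \<open>n + 1\<close> changes the stopped sum, in each dyadic cell of level \<open>n\<close>, by
  the increment of \<open>f\<close> over the left half times the increment of the stopped \<open>g\<close> over the right
  half. Every cell other than the one containing \<open>t\<close> contributes a product of true dyadic
  increments of level \<open>n + 1\<close>, or nothing. The cell containing \<open>t\<close> contributes at most
  \<open>2 * \<parallel>g\<parallel>\<^sub>\<infinity>\<close> times the largest increment of \<open>f\<close> at level \<open>n + 1\<close>
  (\<open>abs_stopped_sum_Suc_diff_le\<close>). Both contributions are summable over \<open>n\<close>, uniformly in \<open>t\<close>.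

  For the products, let \<open>1 / p + 1 / q \<ge> 1\<close>. A Hoelder inequality over all levels and
  cells at once (\<open>sum_mult_le_powr\<close>) reduces the claim to the \<open>p\<close>-th powers of all dyadic increments
  of \<open>f\<close>, and the \<open>q\<close>-th powers of those of \<open>g\<close>, having a finite sum. An increment of level
  \<open>n + 1\<close> is half of the sum or difference of an increment of level \<open>n\<close> and a Schauder second
  difference. Splitting an increment into two equal halves multiplies its \<open>p\<close>-th power sum by
  \<open>2 powr (1 - p)\<close>, which is less than 1 as \<open>p > 1\<close>; by convexity, the full recursion is still a
  contraction, of rate \<open>(2 / 3) powr (p - 1)\<close>, driven by the level energies
  (\<open>variation_Suc_le\<close>). Summing this recursion bounds the increments by the energy norm
  (\<open>sum_variation_le\<close>).

  The largest increments satisfy the same kind of recursion with rate \<open>1 / 2\<close>, driven by the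
  terms of the tail sequence (\<open>sum_max_inc_le\<close>).

  The left sums are bilinear, so bilinearity of the integral follows from uniqueness of the
  continuous extension. The energy spaces are closed under linear combinations because the
  Faber--Schauder coefficients are linear in the function.
\<close>

section \<open>Dyadic increments\<close>

definition inc :: "(real \<Rightarrow> real) \<Rightarrow> nat \<Rightarrow> nat \<Rightarrow> real" where
  "inc f n k = f (dyad n (k + 1)) - f (dyad n k)"

text \<open>
  The Faber--Schauder coefficient of level \<open>n\<close> and position \<open>k\<close> without its factor \<open>2 powr (n / 2)\<close>.
\<close>

definition bump :: "(real \<Rightarrow> real) \<Rightarrow> nat \<Rightarrow> nat \<Rightarrow> real" where
  "bump f n k = 2 * f (dyad (n + 1) (2 * k + 1)) - f (dyad n k) - f (dyad n (k + 1))"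

definition variation :: "real \<Rightarrow> (real \<Rightarrow> real) \<Rightarrow> nat \<Rightarrow> real" where
  "variation p f n = (\<Sum>k<2 ^ n. \<bar>inc f n k\<bar> powr p)"

text \<open>
  The \<open>p\<close>-th power of the level energy; taking the root only at the very end keeps the
  recursion for the variations linear.
\<close>

definition bump_energy :: "real \<Rightarrow> (real \<Rightarrow> real) \<Rightarrow> nat \<Rightarrow> real" where
  "bump_energy p f n = (\<Sum>k<2 ^ n. \<bar>bump f n k\<bar> powr p)"

definition max_inc :: "(real \<Rightarrow> real) \<Rightarrow> nat \<Rightarrow> real" where
  "max_inc f n = (MAX k\<in>{..<2 ^ n}. \<bar>inc f n k\<bar>)"

text \<open>
  The terms of the series that defines the tail sequence; the scaling makes them the largest
  absolute second differences of their level.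
\<close>

definition scaled_sup_coeff :: "(real \<Rightarrow> real) \<Rightarrow> nat \<Rightarrow> real" where
  "scaled_sup_coeff f m = 2 powr (- real m / 2) * (SUP k\<in>{..<2 ^ m}. \<bar>FS_coeff f (int m) k\<bar>)"

lemma dyad_Suc_double [simp]: "dyad (Suc n) (2 * k) = dyad n k"
  by (simp add: dyad_def)

lemma dyad_0 [simp]: "dyad 0 k = real k"
  by (simp add: dyad_def)

lemma dyad_mono: "j \<le> k \<Longrightarrow> dyad n j \<le> dyad n k"
  by (simp add: dyad_def divide_right_mono)

lemma inc_Suc_even: "inc f (Suc n) (2 * k) = (inc f n k + bump f n k) / 2"
  using dyad_Suc_double[of n k] by (simp add: inc_def bump_def field_simps del: dyad_Suc_double)

lemma inc_Suc_odd: "inc f (Suc n) (Suc (2 * k)) = (inc f n k - bump f n k) / 2"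
  using dyad_Suc_double[of n "Suc k"]
  by (simp add: inc_def bump_def field_simps del: dyad_Suc_double)

lemma sum_lessThan_double:
  fixes h :: "nat \<Rightarrow> 'a::comm_monoid_add"
  shows "(\<Sum>k<2 * m. h k) = (\<Sum>k<m. h (2 * k) + h (Suc (2 * k)))"
  by (induction m) (simp_all add: add.assoc)

lemma FS_coeff_eq_bump: "FS_coeff f (int n) k = 2 powr (real n / 2) * bump f n k"
  by (simp add: FS_coeff_def bump_def)

lemma abs_bump_le_scaled_sup_coeff:
  assumes "k < 2 ^ m"
  shows "\<bar>bump f m k\<bar> \<le> scaled_sup_coeff f m"
proof -
  have "\<bar>bump f m k\<bar> = 2 powr (- real m / 2) * \<bar>FS_coeff f (int m) k\<bar>"
    by (simp add: FS_coeff_eq_bump abs_mult mult.assoc[symmetric] powr_add[symmetric])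
  also have "\<dots> \<le> scaled_sup_coeff f m"
    unfolding scaled_sup_coeff_def using assms
    by (intro mult_left_mono cSUP_upper) auto
  finally show ?thesis .
qed

lemma scaled_sup_coeff_nonneg: "scaled_sup_coeff f m \<ge> 0"
  using abs_bump_le_scaled_sup_coeff[of 0 m f] by simp

lemma level_energy_nonneg: "level_energy p f n \<ge> 0"
  by (simp add: level_energy_def)

lemma level_energy_powr:
  assumes "p > 0"
  shows "level_energy p f (int n) powr p = bump_energy p f n"
proof -
  have "bump_energy p f n = 2 powr (- real n * p / 2) * (\<Sum>k<2 ^ n. \<bar>FS_coeff f (int n) k\<bar> powr p)"
    by (simp add: bump_energy_def sum_distrib_left FS_coeff_eq_bump abs_mult powr_mult powr_powr
        mult.assoc[symmetric] powr_add[symmetric])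
  moreover have "bump_energy p f n \<ge> 0"
    by (simp add: bump_energy_def sum_nonneg)
  ultimately show ?thesis
    using assms by (simp add: level_energy_def powr_powr)
qed

lemma le_of_powr_le:
  fixes x y r :: real
  assumes "x powr r \<le> y powr r" "r > 0" "y \<ge> 0"
  shows "x \<le> y"
  using assms powr_less_mono2[of r y x] by (force simp: not_le)

section \<open>The contraction of the dyadic variations\<close>

text \<open>
  Convexity of \<open>\<lambda>x. x powr p\<close>, applied to \<open>(x + y) / 2 = 3/4 * (2/3 * x) + 1/4 * (2 * y)\<close>. The
  weights favour \<open>x\<close>: equal weights would give \<open>x powr p\<close> the factor 1, whereas any weight above
  \<open>1/2\<close> gives it a factor below 1 when \<open>p > 1\<close>.
\<close>

lemma powr_average_le:
  fixes x y p :: real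
  assumes "x \<ge> 0" "y \<ge> 0" "p \<ge> 1"
  shows "2 * ((x + y) / 2) powr p \<le> (2 / 3) powr (p - 1) * x powr p + 2 powr (p - 1) * y powr p"
proof (cases "x > 0 \<and> y > 0")
  case True
  have "((1 - 1/4) *\<^sub>R (2/3 * x) + (1/4) *\<^sub>R (2 * y)) powr p
      \<le> (1 - 1/4) * (2/3 * x) powr p + 1/4 * (2 * y) powr p"
    using True by (intro convex_onD[OF powr_convex[OF assms(3)]]) auto
  also have "(1 - 1/4) *\<^sub>R (2/3 * x) + (1/4) *\<^sub>R (2 * y) = (x + y) / 2"
    by (simp add: field_simps)
  also have "(2/3 * x) powr p = 2/3 * ((2/3) powr (p - 1) * x powr p)"
    using True powr_mult[of "2/3" x p] by (simp add: powr_diff)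
  also have "(2 * y) powr p = 2 * (2 powr (p - 1) * y powr p)"
    using True powr_mult[of 2 y p] by (simp add: powr_diff)
  finally show ?thesis by argo
next
  case False
  \<comment> \<open>\<open>powr_convex\<close> covers positive arguments, so a vanishing one is treated by hand.\<close>
  have half: "2 * (z / 2) powr p = (1 / 2) powr (p - 1) * z powr p" if "z \<ge> 0" for z :: real
    using that by (simp add: powr_divide powr_diff)
  have "(1 / 2) powr (p - 1) \<le> (2 / 3) powr (p - 1)" "(1 / 2) powr (p - 1) \<le> (2::real) powr (p - 1)"
    using assms(3) by (auto intro!: powr_mono2)
  then show ?thesis
    using False assms half[of x] half[of y] by (auto intro!: mult_right_mono simp: not_less)
qed

lemma variation_nonneg: "variation p f n \<ge> 0"
  by (simp add: variation_def sum_nonneg)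

text \<open>
  Both halves of a cell have an increment of size at most the average of the old increment and
  the second difference, which is the situation of \<open>powr_average_le\<close>.
\<close>

lemma variation_Suc_le:
  assumes "p \<ge> 1"
  shows "variation p f (Suc n) \<le> (2 / 3) powr (p - 1) * variation p f n + 2 powr (p - 1) * bump_energy p f n"
proof -
  have "variation p f (Suc n) =
      (\<Sum>k<2 ^ n. \<bar>inc f (Suc n) (2 * k)\<bar> powr p + \<bar>inc f (Suc n) (Suc (2 * k))\<bar> powr p)"
    by (simp add: variation_def sum_lessThan_double)
  also have "\<dots> \<le> (\<Sum>k<2 ^ n. 2 * ((\<bar>inc f n k\<bar> + \<bar>bump f n k\<bar>) / 2) powr p)"
  proof (rule sum_mono)
    fix k
    have "\<bar>inc f (Suc n) (2 * k)\<bar> powr p \<le> ((\<bar>inc f n k\<bar> + \<bar>bump f n k\<bar>) / 2) powr p"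
      "\<bar>inc f (Suc n) (Suc (2 * k))\<bar> powr p \<le> ((\<bar>inc f n k\<bar> + \<bar>bump f n k\<bar>) / 2) powr p"
      using assms by (auto intro!: powr_mono2 simp: inc_Suc_even inc_Suc_odd)
    then show "\<bar>inc f (Suc n) (2 * k)\<bar> powr p + \<bar>inc f (Suc n) (Suc (2 * k))\<bar> powr p
        \<le> 2 * ((\<bar>inc f n k\<bar> + \<bar>bump f n k\<bar>) / 2) powr p"
      by linarith
  qed
  also have "\<dots> \<le> (\<Sum>k<2 ^ n. (2 / 3) powr (p - 1) * \<bar>inc f n k\<bar> powr p + 2 powr (p - 1) * \<bar>bump f n k\<bar> powr p)"
    using assms by (intro sum_mono powr_average_le) auto
  finally show ?thesis
    by (simp add: variation_def bump_energy_def sum.distrib sum_distrib_left)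
qed

text \<open>
  Summing the recursion reproduces the sum on the right with the factor \<open>r < 1\<close>, so that it can be
  absorbed into the left side.
\<close>

lemma sum_le_of_contraction:
  fixes u v :: "nat \<Rightarrow> real"
  assumes "\<And>n. u (Suc n) \<le> r * u n + v n" "\<And>n. u n \<ge> 0" "0 \<le> r" "r < 1"
  shows "(\<Sum>n\<le>N. u n) \<le> (u 0 + (\<Sum>n<N. v n)) / (1 - r)"
proof -
  have "(\<Sum>n\<le>N. u n) = u 0 + (\<Sum>n<N. u (Suc n))"
    by (simp add: sum.atMost_shift)
  also have "(\<Sum>n<N. u (Suc n)) \<le> r * (\<Sum>n<N. u n) + (\<Sum>n<N. v n)"
    by (simp add: sum_distrib_left sum.distrib[symmetric] sum_mono assms)
  also have "r * (\<Sum>n<N. u n) \<le> r * (\<Sum>n\<le>N. u n)"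
    using assms by (intro mult_left_mono sum_mono2) auto
  finally show ?thesis
    using assms by (simp add: field_simps)
qed

section \<open>Summability of the increments in terms of the energy norm\<close>

lemma ennreal_powr_ennreal: "x \<ge> 0 \<Longrightarrow> ennreal_powr (ennreal x) r = ennreal (x powr r)"
  by (simp add: ennreal_powr_def)

lemma ennreal_summable_on [simp]: "(f :: 'i \<Rightarrow> ennreal) summable_on A"
  by (rule nonneg_summable_on_complete) simp

lemma sum_le_infsum_ennreal:
  fixes a :: "'i \<Rightarrow> ennreal"
  assumes "finite F" "F \<subseteq> A"
  shows "sum a F \<le> infsum a A"
proof -
  have "infsum a F \<le> infsum a A"
    using assms by (intro infsum_mono_neutral) auto
  then show ?thesis using assms by simp
qed

text \<open>
  Only finite partial sums of the \<open>\<ell>\<^sup>p\<close> norms enter the estimates; in this form they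
  can be computed with in the reals.
\<close>

lemma sum_powr_le_lp_norm:
  assumes "p > 0" "B \<ge> 0" "finite F" "F \<subseteq> A" "lp_norm p A a \<le> ennreal B"
  shows "(\<Sum>i\<in>F. ennreal_powr (a i) p) \<le> ennreal (B powr p)"
proof -
  define X where "X = (\<Sum>\<^sub>\<infinity>i\<in>A. ennreal_powr (a i) p)"
  have le: "ennreal_powr X (1 / p) \<le> ennreal B"
    using assms by (simp add: lp_norm_def X_def)
  then have "X \<noteq> \<infinity>"
    by (auto simp: ennreal_powr_def top_unique)
  then obtain x where x: "x \<ge> 0" "X = ennreal x"
    by (cases X) auto
  then have "x powr (1 / p) \<le> B"
    using le assms by (simp add: ennreal_powr_ennreal)
  then have "(x powr (1 / p)) powr p \<le> B powr p"
    using assms by (intro powr_mono2) auto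
  then have "X \<le> ennreal (B powr p)"
    using x assms by (simp add: powr_powr ennreal_leI)
  then show ?thesis
    using sum_le_infsum_ennreal[OF assms(3,4), of "\<lambda>i. ennreal_powr (a i) p"] by (simp add: X_def)
qed

lemma le_lp_norm:
  assumes "p > 0" "B \<ge> 0" "i \<in> A" "lp_norm p A a \<le> ennreal B"
  shows "a i \<le> ennreal B"
proof -
  have le: "ennreal_powr (a i) p \<le> ennreal (B powr p)"
    using sum_powr_le_lp_norm[of p B "{i}" A a] assms by simp
  then have "a i \<noteq> \<infinity>"
    by (auto simp: ennreal_powr_def top_unique)
  then obtain x where x: "x \<ge> 0" "a i = ennreal x"
    by (cases "a i") auto
  then have "x powr p \<le> B powr p"
    using le assms by (simp add: ennreal_powr_ennreal)
  then have "x \<le> B"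
    using assms by (intro le_of_powr_le[of x p B]) auto
  then show ?thesis using x by (simp add: ennreal_leI)
qed

lemma energy_norm_components:
  assumes "energy_norm p f \<le> c"
  shows "sup_norm f \<le> c"
    and "lp_norm p {-1..} (\<lambda>n. ennreal (level_energy p f n)) \<le> c"
    and "lp_norm p UNIV (tail_seq f) \<le> c"
proof -
  have "sup_norm f \<le> energy_norm p f"
    "lp_norm p {-1..} (\<lambda>n. ennreal (level_energy p f n)) \<le> energy_norm p f"
    "lp_norm p UNIV (tail_seq f) \<le> energy_norm p f"
    unfolding energy_norm_def by (auto intro!: add_increasing add_increasing2)
  then show "sup_norm f \<le> c" "lp_norm p {-1..} (\<lambda>n. ennreal (level_energy p f n)) \<le> c"
    "lp_norm p UNIV (tail_seq f) \<le> c"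
    using assms by (meson order_trans)+
qed

text \<open>
  The three ingredients of the energy norm in the form in which the estimates use them. The term
  \<open>variation p f 0\<close> is \<open>\<bar>f 1 - f 0\<bar> powr p\<close>, which level \<open>-1\<close> controls because its factor
  \<open>2 powr (1 - 1 / p)\<close> is at least 1. The last bound is the tail sequence at index 0, a single entry
  of a sequence in \<open>\<ell>\<^sup>p\<close>.
\<close>

lemma bounds_of_energy_norm:
  assumes "p > 1" "F \<ge> 0" "energy_norm p f \<le> ennreal F"
  shows "x \<in> {0..1} \<Longrightarrow> \<bar>f x\<bar> \<le> F"
    and "variation p f 0 + (\<Sum>n<N. bump_energy p f n) \<le> F powr p"
    and "(\<Sum>m<N. scaled_sup_coeff f m) \<le> F"
proof -
  note sup = energy_norm_components(1)[OF assms(3)]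
    and zeta = energy_norm_components(2)[OF assms(3)]
    and tail = energy_norm_components(3)[OF assms(3)]
  show "\<bar>f x\<bar> \<le> F" if "x \<in> {0..1}"
  proof -
    have "ennreal \<bar>f x\<bar> \<le> sup_norm f"
      unfolding sup_norm_def using that by (intro SUP_upper)
    then show ?thesis
      using sup assms(2) by (meson ennreal_le_iff order_trans)
  qed
  show "variation p f 0 + (\<Sum>n<N. bump_energy p f n) \<le> F powr p"
  proof -
    have "(\<Sum>i\<in>insert (-1) (int ` {..<N}). ennreal_powr (ennreal (level_energy p f i)) p)
        \<le> ennreal (F powr p)"
      using assms zeta by (intro sum_powr_le_lp_norm) auto
    then have "(\<Sum>i\<in>insert (-1) (int ` {..<N}). level_energy p f i powr p) \<le> F powr p"
      by (simp add: ennreal_powr_ennreal level_energy_nonneg del: sum.insert)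
    moreover have "-1 \<notin> int ` {..<N}" by auto
    ultimately have "level_energy p f (-1) powr p + (\<Sum>n<N. bump_energy p f n) \<le> F powr p"
      using assms by (simp add: sum.reindex level_energy_powr)
    moreover have "variation p f 0 \<le> level_energy p f (-1) powr p"
    proof -
      have "1 \<le> (2::real) powr (1 - 1 / p)"
        using assms by (intro ge_one_powr_ge_zero) auto
      then have "\<bar>f 1 - f 0\<bar> \<le> level_energy p f (-1)"
        by (simp add: level_energy_def FS_coeff_def mult_le_cancel_right1)
      then show ?thesis
        using assms by (auto simp: variation_def inc_def intro!: powr_mono2)
    qed
    ultimately show ?thesis by linarith
  qed
  show "(\<Sum>m<N. scaled_sup_coeff f m) \<le> F"
  proof -
    have "tail_seq f 0 \<le> ennreal F"
      by (rule le_lp_norm[OF _ assms(2) UNIV_I tail]) (use assms(1) in simp)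
    moreover have "(\<Sum>m<N. ennreal (scaled_sup_coeff f m)) \<le> tail_seq f 0"
      unfolding tail_seq_def scaled_sup_coeff_def by (intro sum_le_infsum_ennreal) auto
    ultimately have "ennreal (\<Sum>m<N. scaled_sup_coeff f m) \<le> ennreal F"
      by (simp add: scaled_sup_coeff_nonneg)
    then show ?thesis using assms by simp
  qed
qed

lemma sum_variation_le:
  assumes "p > 1" "F \<ge> 0" "energy_norm p f \<le> ennreal F"
  shows "(\<Sum>n\<le>N. variation p f n) \<le> 2 powr (p - 1) / (1 - (2 / 3) powr (p - 1)) * F powr p"
proof -
  have r: "(2 / 3) powr (p - 1) < (1::real)"
    using assms powr_less_mono2[of "p - 1" "2/3" 1] by simp
  have "(\<Sum>n\<le>N. variation p f n)
      \<le> (variation p f 0 + (\<Sum>n<N. 2 powr (p - 1) * bump_energy p f n)) / (1 - (2 / 3) powr (p - 1))"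
    using assms r by (intro sum_le_of_contraction variation_Suc_le variation_nonneg) auto
  also have "\<dots> \<le> 2 powr (p - 1) * (variation p f 0 + (\<Sum>n<N. bump_energy p f n)) / (1 - (2 / 3) powr (p - 1))"
  proof (intro divide_right_mono)
    have "variation p f 0 \<le> 2 powr (p - 1) * variation p f 0"
      using assms variation_nonneg[of p f 0] ge_one_powr_ge_zero[of 2 "p - 1"]
      by (simp add: mult_le_cancel_right1)
    then show "variation p f 0 + (\<Sum>n<N. 2 powr (p - 1) * bump_energy p f n)
        \<le> 2 powr (p - 1) * (variation p f 0 + (\<Sum>n<N. bump_energy p f n))"
      by (simp add: sum_distrib_left[symmetric] distrib_left)
  qed (use r in simp)
  also have "\<dots> \<le> 2 powr (p - 1) * F powr p / (1 - (2 / 3) powr (p - 1))"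
    using r bounds_of_energy_norm(2)[OF assms] by (intro divide_right_mono mult_left_mono) auto
  finally show ?thesis by simp
qed

lemma abs_inc_le_max_inc: "k < 2 ^ n \<Longrightarrow> \<bar>inc f n k\<bar> \<le> max_inc f n"
  unfolding max_inc_def by (intro Max_ge) auto

lemma max_inc_Suc_le: "max_inc f (Suc n) \<le> 1 / 2 * max_inc f n + scaled_sup_coeff f n / 2"
proof -
  have "\<bar>inc f (Suc n) k\<bar> \<le> 1 / 2 * max_inc f n + scaled_sup_coeff f n / 2" if "k < 2 ^ Suc n" for k
  proof -
    define j where "j = k div 2"
    have j: "j < 2 ^ n" using that by (auto simp: j_def)
    have "k = 2 * j \<or> k = Suc (2 * j)" by (auto simp: j_def)
    then have "\<bar>inc f (Suc n) k\<bar> \<le> (\<bar>inc f n j\<bar> + \<bar>bump f n j\<bar>) / 2"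
      by (auto simp: inc_Suc_even inc_Suc_odd)
    then show ?thesis
      using abs_inc_le_max_inc[OF j, of f] abs_bump_le_scaled_sup_coeff[OF j, of f]
      by (simp add: field_simps)
  qed
  then show ?thesis
    unfolding max_inc_def[of f "Suc n"] by (subst Max_le_iff) (auto simp: lessThan_empty_iff)
qed

lemma max_inc_nonneg: "max_inc f n \<ge> 0"
  using abs_inc_le_max_inc[of 0 n f] by simp

lemma sum_max_inc_le:
  assumes "p > 1" "F \<ge> 0" "energy_norm p f \<le> ennreal F"
  shows "(\<Sum>n\<le>N. max_inc f n) \<le> 5 * F"
proof -
  have "(\<Sum>n\<le>N. max_inc f n) \<le> (max_inc f 0 + (\<Sum>n<N. scaled_sup_coeff f n / 2)) / (1 - 1 / 2)"
    by (intro sum_le_of_contraction max_inc_Suc_le max_inc_nonneg) auto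
  moreover have "(\<Sum>n<N. scaled_sup_coeff f n / 2) \<le> F / 2"
    using bounds_of_energy_norm(3)[OF assms, of N] by (simp add: sum_divide_distrib[symmetric])
  moreover have "max_inc f 0 \<le> 2 * F"
    using bounds_of_energy_norm(1)[OF assms, of 0] bounds_of_energy_norm(1)[OF assms, of 1]
    by (simp add: max_inc_def inc_def lessThan_Suc)
  ultimately show ?thesis by simp
qed

section \<open>A Hoelder inequality\<close>

text \<open>
  Hoelder's inequality for counting measure with exponents whose reciprocals may add up to more
  than 1. After scaling to \<open>A = B = 1\<close> all entries lie in \<open>{0..1}\<close>, and there
  \<open>u * v \<le> u powr p + v powr q\<close>: with \<open>w = max (u powr p) (v powr q)\<close> one has
  \<open>u * v \<le> w powr (1 / p + 1 / q) \<le> w\<close>. This crude replacement of Young's inequality costs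
  the factor 2.
\<close>

lemma sum_mult_le_powr:
  fixes a b :: "'i \<Rightarrow> real"
  assumes "finite S" "p > 0" "q > 0" "1 / p + 1 / q \<ge> 1" "A \<ge> 0" "B \<ge> 0"
    and nonneg: "\<And>i. i \<in> S \<Longrightarrow> a i \<ge> 0" "\<And>i. i \<in> S \<Longrightarrow> b i \<ge> 0"
    and a: "(\<Sum>i\<in>S. a i powr p) \<le> A powr p" and b: "(\<Sum>i\<in>S. b i powr q) \<le> B powr q"
  shows "(\<Sum>i\<in>S. a i * b i) \<le> 2 * A * B"
proof -
  have le: "c i \<le> C" if "(\<Sum>i\<in>S. c i powr r) \<le> C powr r" "\<And>i. i \<in> S \<Longrightarrow> c i \<ge> 0" "i \<in> S" "r > 0" "C \<ge> 0"
    for c :: "'i \<Rightarrow> real" and C r i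
  proof -
    have "c i powr r \<le> C powr r"
      using that member_le_sum[of i S "\<lambda>i. c i powr r"] assms(1) by auto
    then show ?thesis
      using that by (intro le_of_powr_le[of "c i" r C]) auto
  qed
  note aA = le[OF a nonneg(1) _ assms(2,5)] and bB = le[OF b nonneg(2) _ assms(3,6)]
  show ?thesis
  proof (cases "A = 0 \<or> B = 0")
    case True
    then have "a i * b i = 0" if "i \<in> S" for i
      using aA[OF _ that] bB[OF _ that] nonneg[OF that] by force
    then have "(\<Sum>i\<in>S. a i * b i) = 0"
      by (intro sum.neutral) auto
    then show ?thesis using True by auto
  next
    case False
    then have pos: "A > 0" "B > 0" using assms by auto
    have young: "u * v \<le> u powr p + v powr q" if "0 \<le> u" "u \<le> 1" "0 \<le> v" "v \<le> 1" for u v :: real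
    proof -
      define w where "w = max (u powr p) (v powr q)"
      have w: "0 \<le> w" "w \<le> 1" 
        using that assms by (auto simp: w_def powr_le1 le_max_iff_disj)
      have "u = (u powr p) powr (1 / p)" "v = (v powr q) powr (1 / q)"
        using that assms by (auto simp: powr_powr)
      moreover have "(u powr p) powr (1 / p) \<le> w powr (1 / p)"
        "(v powr q) powr (1 / q) \<le> w powr (1 / q)"
        using assms by (auto intro!: powr_mono2 simp: w_def)
      ultimately have "u \<le> w powr (1 / p)" "v \<le> w powr (1 / q)"
        by simp_all
      then have "u * v \<le> w powr (1 / p) * w powr (1 / q)"
        using that by (intro mult_mono) auto
      also have "\<dots> = w powr (1 / p + 1 / q)" by (simp add: powr_add)
      also have "\<dots> \<le> w powr 1"
        using w assms by (intro powr_mono') auto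
      also have "\<dots> \<le> u powr p + v powr q"
        using w by (auto simp: w_def)
      finally show ?thesis .
    qed
    have "(\<Sum>i\<in>S. (a i / A) * (b i / B)) \<le> (\<Sum>i\<in>S. (a i / A) powr p + (b i / B) powr q)"
      using pos aA bB nonneg by (intro sum_mono young) (auto simp: divide_le_eq)
    also have "\<dots> = (\<Sum>i\<in>S. a i powr p) / A powr p + (\<Sum>i\<in>S. b i powr q) / B powr q"
      using nonneg pos by (simp add: sum.distrib powr_divide sum_divide_distrib)
    also have "\<dots> \<le> 1 + 1"
      using a b pos by (intro add_mono) (auto simp: divide_le_eq)
    finally show ?thesis
      using pos by (simp add: sum_divide_distrib[symmetric] divide_le_eq)
  qed
qed

section \<open>Uniform convergence of the stopped left sums\<close>

text \<open>
  The left sum of level \<open>n\<close> over all of \<open>{0..1}\<close> with \<open>g\<close> stopped at time \<open>t\<close>. It extends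
  \<open>left_sum n\<close> from the grid of level \<open>n\<close> to a continuous function of \<open>t\<close>.
\<close>

definition stopped_sum :: "(real \<Rightarrow> real) \<Rightarrow> (real \<Rightarrow> real) \<Rightarrow> nat \<Rightarrow> real \<Rightarrow> real" where
  "stopped_sum f g n t =
     (\<Sum>k<2 ^ n. f (dyad n k) * (g (min t (dyad n (k + 1))) - g (min t (dyad n k))))"

text \<open>
  Cells to the right of \<open>t\<close> see a constant integrator, and cells to the left of it are not affected
  by the stopping.
\<close>

lemma stopped_sum_dyad:
  assumes "N \<le> 2 ^ n"
  shows "stopped_sum f g n (dyad n N) = left_sum n (dyad n N) f g"
proof -
  have "stopped_sum f g n (dyad n N) = (\<Sum>k<N. f (dyad n k) * (g (dyad n (k + 1)) - g (dyad n k)))"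
    unfolding stopped_sum_def
  proof (rule sum.mono_neutral_cong_right)
    show "\<forall>i\<in>{..<2 ^ n} - {..<N}.
        f (dyad n i) * (g (min (dyad n N) (dyad n (i + 1))) - g (min (dyad n N) (dyad n i))) = 0"
      using dyad_mono[of N _ n] by (auto simp: min_absorb1 not_less)
    show "f (dyad n i) * (g (min (dyad n N) (dyad n (i + 1))) - g (min (dyad n N) (dyad n i)))
        = f (dyad n i) * (g (dyad n (i + 1)) - g (dyad n i))" if "i \<in> {..<N}" for i
      using that by (simp add: min_absorb2 dyad_mono)
  qed (use assms in auto)
  moreover have "nat \<lfloor>2 ^ n * dyad n N\<rfloor> = N"
    by (simp add: dyad_def)
  ultimately show ?thesis
    by (simp add: left_sum_def)
qed

lemma dyadic_grid_mono: "m \<le> n \<Longrightarrow> dyadic_grid m \<subseteq> dyadic_grid n"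
proof (rule lift_Suc_mono_le)
  show "dyadic_grid n \<subseteq> dyadic_grid (Suc n)" for n
  proof
    fix x assume "x \<in> dyadic_grid n"
    then obtain k where "k \<le> 2 ^ n" "x = dyad n k"
      by (auto simp: dyadic_grid_def)
    then show "x \<in> dyadic_grid (Suc n)"
      unfolding dyadic_grid_def by (intro image_eqI[of _ _ "2 * k"]) auto
  qed
qed

lemma stopped_sum_eq_left_sum:
  assumes "t \<in> dyadic_points" "level t \<le> n"
  shows "stopped_sum f g n t = left_sum n t f g"
proof -
  have "t \<in> dyadic_grid (level t)"
    unfolding level_def using assms(1) by (auto simp: dyadic_points_def intro: LeastI)
  then have "t \<in> dyadic_grid n"
    using dyadic_grid_mono[OF assms(2)] by auto
  then show ?thesis
    by (auto simp: dyadic_grid_def stopped_sum_dyad)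
qed

lemma continuous_on_stopped_sum:
  assumes "continuous_on {0..1} g"
  shows "continuous_on {0..1} (stopped_sum f g n)"
  unfolding stopped_sum_def
proof (intro continuous_on_sum continuous_on_mult continuous_on_const continuous_on_diff)
  have *: "continuous_on {0..1} (\<lambda>t. g (min t (dyad n k)))" if "k \<le> 2 ^ n" for k
    using dyad_in_unit[OF that]
    by (intro continuous_on_compose2[OF assms] continuous_intros) auto
  fix k :: nat assume "k \<in> {..<2 ^ n}"
  then show "continuous_on {0..1} (\<lambda>t. g (min t (dyad n (k + 1))))"
    "continuous_on {0..1} (\<lambda>t. g (min t (dyad n k)))"
    using *[of "k + 1"] *[of k] by simp_all
qed

text \<open>
  In a cell with end points \<open>a < b\<close> and midpoint \<open>m\<close>, and with \<open>h\<close> the stopped \<open>g\<close>,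
  \<open>f a * (h m - h a) + f m * (h b - h m) - f a * (h b - h a) = (f m - f a) * (h b - h m)\<close>.
\<close>

lemma stopped_sum_Suc_diff:
  "stopped_sum f g (Suc n) t - stopped_sum f g n t =
     (\<Sum>k<2 ^ n. inc f (Suc n) (2 * k) *
        (g (min t (dyad n (k + 1))) - g (min t (dyad (Suc n) (2 * k + 1)))))"
proof -
  have "dyad (Suc n) (2 * k + 2) = dyad n (k + 1)" for k
    using dyad_Suc_double[of n "k + 1"] by simp
  moreover have "dyad (Suc n) (k * 2) = dyad n k" for k
    using dyad_Suc_double[of n k] by (simp add: mult.commute)
  ultimately show ?thesis
    by (simp add: stopped_sum_def sum_lessThan_double sum_subtractf[symmetric] inc_def algebra_simps)
qed

text \<open>
  The stopping matters only for a cell whose right half contains \<open>t\<close> in its interior, and there is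
  at most one such cell. Right halves to the left of \<open>t\<close> see \<open>g\<close> unchanged, and over right
  halves to the right of \<open>t\<close> the stopped \<open>g\<close> is constant.
\<close>

lemma abs_stopped_sum_Suc_diff_le:
  assumes g: "\<And>x. x \<in> {0..1} \<Longrightarrow> \<bar>g x\<bar> \<le> G" and t: "t \<in> {0..1}"
  shows "\<bar>stopped_sum f g (Suc n) t - stopped_sum f g n t\<bar> \<le>
     (\<Sum>k<2 ^ n. \<bar>inc f (Suc n) (2 * k)\<bar> * \<bar>inc g (Suc n) (Suc (2 * k))\<bar>) + 2 * G * max_inc f (Suc n)"
proof -
  define cut where "cut = {k \<in> {..<2 ^ n}. dyad (Suc n) (2 * k + 1) < t \<and> t < dyad n (k + 1)}"
  have G: "G \<ge> 0" using g[of 0] by auto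
  have dbl: "dyad (Suc n) (2 * k + 2) = dyad n (k + 1)" for k
    using dyad_Suc_double[of n "k + 1"] by simp
  have "\<bar>stopped_sum f g (Suc n) t - stopped_sum f g n t\<bar> \<le>
      (\<Sum>k<2 ^ n. \<bar>inc f (Suc n) (2 * k) *
        (g (min t (dyad n (k + 1))) - g (min t (dyad (Suc n) (2 * k + 1))))\<bar>)"
    unfolding stopped_sum_Suc_diff by (rule sum_abs)
  also have "\<dots> \<le> (\<Sum>k<2 ^ n. \<bar>inc f (Suc n) (2 * k)\<bar> * \<bar>inc g (Suc n) (Suc (2 * k))\<bar>
      + (if k \<in> cut then 2 * G * max_inc f (Suc n) else 0))"
  proof (rule sum_mono)
    fix k :: nat assume k: "k \<in> {..<2 ^ n}"
    let ?m = "dyad (Suc n) (2 * k + 1)" and ?b = "dyad n (k + 1)"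
    have mb: "?m \<le> ?b"
      using dyad_mono[of "2 * k + 1" "2 * k + 2" "Suc n"] dbl by simp
    have m: "?m \<in> {0..1}" using k by (intro dyad_in_unit) auto
    have f: "\<bar>inc f (Suc n) (2 * k)\<bar> \<le> max_inc f (Suc n)"
      using k by (intro abs_inc_le_max_inc) auto
    show "\<bar>inc f (Suc n) (2 * k) * (g (min t ?b) - g (min t ?m))\<bar>
      \<le> \<bar>inc f (Suc n) (2 * k)\<bar> * \<bar>inc g (Suc n) (Suc (2 * k))\<bar>
        + (if k \<in> cut then 2 * G * max_inc f (Suc n) else 0)"
    proof (cases "k \<in> cut")
      case True
      then have "min t ?b = t" "min t ?m = ?m" by (auto simp: cut_def)
      then have "\<bar>g (min t ?b) - g (min t ?m)\<bar> \<le> 2 * G"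
        using g[OF t] g[OF m] by simp
      then have "\<bar>inc f (Suc n) (2 * k)\<bar> * \<bar>g (min t ?b) - g (min t ?m)\<bar> \<le> max_inc f (Suc n) * (2 * G)"
        using f G by (intro mult_mono) (auto simp: max_inc_nonneg)
      moreover have "0 \<le> \<bar>inc f (Suc n) (2 * k)\<bar> * \<bar>inc g (Suc n) (Suc (2 * k))\<bar>"
        by simp
      ultimately show ?thesis
        using True unfolding abs_mult if_P[OF True] mult.commute[of "2 * G"] by linarith
    next
      case False
      then consider "t \<le> ?m" | "?b \<le> t"
        using k by (force simp: cut_def)
      then show ?thesis
      proof cases
        case 1
        then show ?thesis using mb False by (simp add: min_absorb1)
      next
        case 2
        then have "g (min t ?b) - g (min t ?m) = inc g (Suc n) (Suc (2 * k))"
          using mb dbl[of k] by (simp add: min_absorb2 inc_def)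
        then show ?thesis using False by (simp add: abs_mult)
      qed
    qed
  qed
  also have "\<dots> = (\<Sum>k<2 ^ n. \<bar>inc f (Suc n) (2 * k)\<bar> * \<bar>inc g (Suc n) (Suc (2 * k))\<bar>)
      + card cut * (2 * G * max_inc f (Suc n))"
  proof -
    have "cut \<subseteq> {..<2 ^ n}" by (auto simp: cut_def)
    then show ?thesis
      by (simp add: sum.distrib sum.inter_restrict[symmetric] Int_absorb1)
  qed
  also have "\<dots> \<le> (\<Sum>k<2 ^ n. \<bar>inc f (Suc n) (2 * k)\<bar> * \<bar>inc g (Suc n) (Suc (2 * k))\<bar>)
      + 1 * (2 * G * max_inc f (Suc n))"
  proof (intro add_mono order_refl mult_right_mono)
    have "i = j" if ij: "i \<in> cut" "j \<in> cut" for i j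
    proof -
      have "\<not> i < j" if "i \<in> cut" "j \<in> cut" for i j
      proof
        assume "i < j"
        then have "dyad n (i + 1) \<le> dyad (Suc n) (2 * j + 1)"
          unfolding dbl[symmetric] by (intro dyad_mono) simp
        then show False using that by (auto simp: cut_def)
      qed
      then show ?thesis using ij by (meson linorder_neqE_nat)
    qed
    moreover have "finite cut" by (simp add: cut_def)
    ultimately have "card cut \<le> Suc 0" by (subst card_le_Suc0_iff_eq) auto
    then show "real (card cut) \<le> 1" by simp
  qed (use G in \<open>simp add: max_inc_nonneg\<close>)
  finally show ?thesis by simp
qed

text \<open>
  The pairing matches left halves with right halves, so each factor runs through half of the
  increments of its level, and its power sum is bounded by the full variation.
\<close>

lemma sum_cross_inc_le:
  assumes "p > 0" "q > 0" "1 / p + 1 / q \<ge> 1" "A \<ge> 0" "B \<ge> 0"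
    and f: "(\<Sum>n\<le>N. variation p f n) \<le> A powr p"
    and g: "(\<Sum>n\<le>N. variation q g n) \<le> B powr q"
  shows "(\<Sum>n<N. \<Sum>k<2 ^ n. \<bar>inc f (Suc n) (2 * k)\<bar> * \<bar>inc g (Suc n) (Suc (2 * k))\<bar>) \<le> 2 * A * B"
proof -
  let ?S = "SIGMA n:{..<N}. {..<2 ^ n :: nat}"
  have sum_le: "(\<Sum>n<N. \<Sum>k<2 ^ n. \<bar>inc h (Suc n) (j k)\<bar> powr r) \<le> (\<Sum>n\<le>N. variation r h n)"
    if "\<And>k. j k = 2 * k \<or> j k = Suc (2 * k)" for h r and j :: "nat \<Rightarrow> nat"
  proof -
    have "(\<Sum>k<2 ^ n. \<bar>inc h (Suc n) (j k)\<bar> powr r) \<le> variation r h (Suc n)" for n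
      unfolding variation_def power_Suc sum_lessThan_double
    proof (rule sum_mono)
      fix k show "\<bar>inc h (Suc n) (j k)\<bar> powr r
          \<le> \<bar>inc h (Suc n) (2 * k)\<bar> powr r + \<bar>inc h (Suc n) (Suc (2 * k))\<bar> powr r"
        using that[of k] by auto
    qed
    then have "(\<Sum>n<N. \<Sum>k<2 ^ n. \<bar>inc h (Suc n) (j k)\<bar> powr r) \<le> (\<Sum>n<N. variation r h (Suc n))"
      by (rule sum_mono)
    also have "\<dots> \<le> (\<Sum>n\<le>N. variation r h n)"
      by (simp add: sum.atMost_shift variation_nonneg)
    finally show ?thesis .
  qed
  have "(\<Sum>(n, k)\<in>?S. \<bar>inc f (Suc n) (2 * k)\<bar> powr p) \<le> A powr p"
    "(\<Sum>(n, k)\<in>?S. \<bar>inc g (Suc n) (Suc (2 * k))\<bar> powr q) \<le> B powr q"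
    using sum_le[of "\<lambda>k. 2 * k" f p] sum_le[of "\<lambda>k. Suc (2 * k)" g q] f g
    by (simp_all add: sum.Sigma)
  then have "(\<Sum>i\<in>?S. (case i of (n, k) \<Rightarrow> \<bar>inc f (Suc n) (2 * k)\<bar>) *
      (case i of (n, k) \<Rightarrow> \<bar>inc g (Suc n) (Suc (2 * k))\<bar>)) \<le> 2 * A * B"
    using assms(1-5)
    by (intro sum_mult_le_powr[of _ p q]) (auto simp: case_prod_unfold)
  then show ?thesis
    by (simp add: sum.Sigma case_prod_unfold)
qed

text \<open>
  The constant in \<open>sum_variation_le\<close> as a factor of \<open>F\<close>, that is, drawn under the \<open>p\<close>-th power.
\<close>

definition energy_factor :: "real \<Rightarrow> real" where
  "energy_factor p = (2 powr (p - 1) / (1 - (2 / 3) powr (p - 1))) powr (1 / p)"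

text \<open>
  Weierstrass' test for the telescoping series of the stopped sums. In the constant,
  \<open>2 * energy_factor p * energy_factor q\<close> comes from the products of increments, \<open>10 = 2 * 5\<close> from
  the cells containing \<open>t\<close>, and the remaining 2 from the stopped sum \<open>f 0 * (g t - g 0)\<close> of level 0.
\<close>

lemma ex_FS_integral_bounded:
  assumes pq: "p > 1" "q > 1" "1 / p + 1 / q \<ge> 1"
    and f: "F \<ge> 0" "energy_norm p f \<le> ennreal F"
    and g: "continuous_on {0..1} g" "G \<ge> 0" "energy_norm q g \<le> ennreal G"
  shows "\<exists>J. is_FS_integral f g J \<and>
    (\<forall>t\<in>{0..1}. \<bar>J t\<bar> \<le> (2 * energy_factor p * energy_factor q + 12) * F * G)"
proof -
  define A where "A n = (\<Sum>k<2 ^ n. \<bar>inc f (Suc n) (2 * k)\<bar> * \<bar>inc g (Suc n) (Suc (2 * k))\<bar>)" for n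
  define M where "M n = A n + 2 * G * max_inc f (Suc n)" for n
  define D where "D n t = stopped_sum f g (Suc n) t - stopped_sum f g n t" for n t
  define K where "K = (2 * energy_factor p * energy_factor q + 10) * F * G"
  define J where "J t = stopped_sum f g 0 t + (\<Sum>n. D n t)" for t
  have var: "(\<Sum>n\<le>N. variation r h n) \<le> (energy_factor r * H) powr r"
    if "r > 1" "H \<ge> 0" "energy_norm r h \<le> ennreal H" for r h H N
  proof -
    have "(2 / 3) powr (r - 1) < (1::real)"
      using that powr_less_mono2[of "r - 1" "2/3" 1] by simp
    then have "2 powr (r - 1) / (1 - (2 / 3) powr (r - 1)) = energy_factor r powr r"
      using that by (simp add: energy_factor_def powr_powr)
    then show ?thesis
      using sum_variation_le[OF that, of N] that by (simp add: powr_mult energy_factor_def)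
  qed
  have Mle: "(\<Sum>n<N. M n) \<le> K" for N
  proof -
    have "(\<Sum>n<N. A n) \<le> 2 * (energy_factor p * F) * (energy_factor q * G)"
      unfolding A_def using pq f g
      by (intro sum_cross_inc_le[of p q] var) (auto simp: energy_factor_def)
    moreover have "(\<Sum>n<N. max_inc f (Suc n)) \<le> 5 * F"
      using sum_max_inc_le[OF pq(1) f, of N] max_inc_nonneg[of f 0] by (simp add: sum.atMost_shift)
    then have "2 * G * (\<Sum>n<N. max_inc f (Suc n)) \<le> 2 * G * (5 * F)"
      using g by (intro mult_left_mono) auto
    ultimately show ?thesis
      by (simp add: M_def K_def sum.distrib sum_distrib_left algebra_simps)
  qed
  have M: "M n \<ge> 0" for n
    using g by (simp add: M_def A_def sum_nonneg max_inc_nonneg)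
  have sM: "summable M"
    using M Mle by (rule summableI_nonneg_bounded)
  have DM: "norm (D n t) \<le> M n" if "t \<in> {0..1}" for n t
    unfolding D_def M_def A_def real_norm_def
    using bounds_of_energy_norm(1)[OF pq(2) g(2,3)] that by (intro abs_stopped_sum_Suc_diff_le)
  have tele: "stopped_sum f g 0 t + (\<Sum>n<N. D n t) = stopped_sum f g N t" for N t
    by (induction N) (simp_all add: D_def)
  have "uniform_limit {0..1} (\<lambda>N t. stopped_sum f g 0 t + (\<Sum>n<N. D n t)) J sequentially"
    unfolding J_def by (intro uniform_limit_add uniform_limit_const Weierstrass_m_test[OF DM sM])
  then have lim: "uniform_limit {0..1} (stopped_sum f g) J sequentially"
    by (simp add: tele)
  have cont: "continuous_on {0..1} J"
    by (rule uniform_limit_theorem[OF _ lim]) (auto intro!: always_eventually continuous_on_stopped_sum g(1))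
  have conv: "(\<lambda>i. left_sum (level t + i) t f g) \<longlonglongrightarrow> J t" if t: "t \<in> dyadic_points" for t
  proof -
    have "t \<in> {0..1}" using t dyadic_points_subset by auto
    then have "(\<lambda>n. stopped_sum f g n t) \<longlonglongrightarrow> J t"
      by (rule tendsto_uniform_limitI[OF lim])
    then have "(\<lambda>i. stopped_sum f g (i + level t) t) \<longlonglongrightarrow> J t"
      by (rule LIMSEQ_ignore_initial_segment)
    then show ?thesis
      using t by (simp add: stopped_sum_eq_left_sum add.commute)
  qed
  have "is_FS_integral f g J"
    unfolding is_FS_integral_def dyadic_integral_exists_def dyadic_integral_def C01_def
    using cont conv by (auto simp: convergent_def limI[symmetric])
  moreover have "\<bar>J t\<bar> \<le> (2 * energy_factor p * energy_factor q + 12) * F * G" if t: "t \<in> {0..1}" for t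
  proof -
    note fb = bounds_of_energy_norm(1)[OF pq(1) f] and gb = bounds_of_energy_norm(1)[OF pq(2) g(2,3)]
    have "\<bar>stopped_sum f g 0 t\<bar> = \<bar>f 0\<bar> * \<bar>g t - g 0\<bar>"
      using t by (simp add: stopped_sum_def abs_mult)
    also have "\<dots> \<le> F * (2 * G)"
      using fb[of 0] gb[OF t] gb[of 0] f g by (intro mult_mono) auto
    finally have "\<bar>stopped_sum f g 0 t\<bar> \<le> 2 * F * G" by simp
    moreover have "norm (\<Sum>n. D n t) \<le> suminf M"
      by (rule norm_suminf_le) (use sM DM[OF t] in auto)
    moreover have "suminf M \<le> K"
      using sM Mle by (rule suminf_le_const)
    ultimately show ?thesis
      by (simp add: J_def K_def algebra_simps)
  qed
  ultimately show ?thesis by blast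
qed

section \<open>Linearity\<close>

lemma energy_space_norm:
  assumes "f \<in> energy_space p"
  obtains F where "F \<ge> 0" "energy_norm p f = ennreal F"
  using assms by (cases "energy_norm p f") (auto simp: energy_space_def)

lemma is_FS_integral_of_energy_space:
  assumes "p > 1" "q > 1" "1 / p + 1 / q \<ge> 1" "f \<in> energy_space p" "g \<in> energy_space q"
  shows "is_FS_integral f g (FS_integral f g)"
proof -
  obtain F G where "F \<ge> 0" "energy_norm p f = ennreal F" "G \<ge> 0" "energy_norm q g = ennreal G"
    using assms energy_space_norm by metis
  moreover have "continuous_on {0..1} g"
    using assms by (simp add: energy_space_def C01_def)
  ultimately show ?thesis
    using ex_FS_integral_bounded[OF assms(1-3), of F f g G]
    by (intro is_FS_integral_FS_integral) (auto simp: FS_integral_exists_def)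
qed

lemma is_FS_integral_lincomb:
  assumes "is_FS_integral f1 g1 J1" "is_FS_integral f2 g2 J2"
    and "\<And>n t. left_sum n t f g = a * left_sum n t f1 g1 + b * left_sum n t f2 g2"
  shows "is_FS_integral f g (\<lambda>t. a * J1 t + b * J2 t)"
proof -
  have lim: "(\<lambda>i. left_sum (level t + i) t f g) \<longlonglongrightarrow> a * J1 t + b * J2 t"
    if "t \<in> dyadic_points" for t
    unfolding assms(3)
    using assms(1,2) that unfolding is_FS_integral_def dyadic_integral_exists_def dyadic_integral_def
    by (intro tendsto_intros) (simp_all add: convergent_LIMSEQ_iff)
  have "continuous_on {0..1} (\<lambda>t. a * J1 t + b * J2 t)"
    using assms(1,2) by (auto simp: is_FS_integral_def C01_def intro!: continuous_intros)
  then show ?thesis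
    unfolding is_FS_integral_def dyadic_integral_exists_def dyadic_integral_def C01_def
    using lim by (auto simp: convergent_def limI[symmetric])
qed

lemma left_sum_lincomb_left:
  "left_sum n t (\<lambda>x. a * f1 x + b * f2 x) g = a * left_sum n t f1 g + b * left_sum n t f2 g"
  by (simp add: left_sum_def sum_distrib_left sum.distrib[symmetric] algebra_simps)

lemma left_sum_lincomb_right:
  "left_sum n t f (\<lambda>x. a * g1 x + b * g2 x) = a * left_sum n t f g1 + b * left_sum n t f g2"
  by (simp add: left_sum_def sum_distrib_left sum.distrib[symmetric] algebra_simps)

text \<open>
  The sum of two terms is at most twice the larger one. This replaces Minkowski's inequality,
  since linear combinations only have to have finite norm.
\<close>

lemma abs_lincomb_powr_le:
  fixes a b x y p :: real
  assumes "p \<ge> 0"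
  shows "\<bar>a * x + b * y\<bar> powr p \<le> (2 * \<bar>a\<bar>) powr p * \<bar>x\<bar> powr p + (2 * \<bar>b\<bar>) powr p * \<bar>y\<bar> powr p"
proof -
  have "\<bar>a * x + b * y\<bar> \<le> 2 * max (\<bar>a\<bar> * \<bar>x\<bar>) (\<bar>b\<bar> * \<bar>y\<bar>)"
    using abs_triangle_ineq[of "a * x" "b * y"] by (auto simp: abs_mult max_def)
  then have "\<bar>a * x + b * y\<bar> powr p \<le> (max (2 * \<bar>a\<bar> * \<bar>x\<bar>) (2 * \<bar>b\<bar> * \<bar>y\<bar>)) powr p"
    using assms by (intro powr_mono2) (auto simp: max_def split: if_splits)
  also have "\<dots> \<le> (2 * \<bar>a\<bar> * \<bar>x\<bar>) powr p + (2 * \<bar>b\<bar> * \<bar>y\<bar>) powr p"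
    by (auto simp: max_def)
  finally show ?thesis by (simp add: powr_mult)
qed

text \<open>
  Multiplication on \<open>[0, \<infinity>]\<close> is not continuous, so constants are moved through the series on
  the level of finite partial sums.
\<close>

lemma infsum_ennreal_lincomb_le:
  fixes u v w :: "'i \<Rightarrow> ennreal"
  assumes "\<And>i. i \<in> A \<Longrightarrow> w i \<le> c * u i + d * v i"
  shows "infsum w A \<le> c * infsum u A + d * infsum v A"
proof -
  have "sum w F \<le> c * infsum u A + d * infsum v A" if F: "finite F" "F \<subseteq> A" for F
  proof -
    have "sum w F \<le> (\<Sum>i\<in>F. c * u i + d * v i)"
      using F assms by (intro sum_mono) auto
    also have "\<dots> = c * sum u F + d * sum v F"
      by (simp add: sum.distrib sum_distrib_left)
    also have "\<dots> \<le> c * infsum u A + d * infsum v A"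
      using F by (intro add_mono mult_left_mono sum_le_infsum_ennreal) auto
    finally show ?thesis .
  qed
  then have "(SUP F\<in>{F. finite F \<and> F \<subseteq> A}. sum w F) \<le> c * infsum u A + d * infsum v A"
    by (intro SUP_least) auto
  then show ?thesis
    by (subst nonneg_infsum_complete) auto
qed

lemma lp_norm_finite_lincomb:
  assumes "lp_norm p A u < \<infinity>" "lp_norm p A v < \<infinity>"
    and le: "\<And>i. i \<in> A \<Longrightarrow> ennreal_powr (w i) p \<le>
      ennreal c * ennreal_powr (u i) p + ennreal d * ennreal_powr (v i) p"
  shows "lp_norm p A w < \<infinity>"
proof -
  have fin: "lp_norm p A x < \<infinity> \<longleftrightarrow> (\<Sum>\<^sub>\<infinity>i\<in>A. ennreal_powr (x i) p) < \<infinity>" for x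
    by (auto simp: lp_norm_def ennreal_powr_def less_top[symmetric])
  have "(\<Sum>\<^sub>\<infinity>i\<in>A. ennreal_powr (w i) p) \<le>
      ennreal c * (\<Sum>\<^sub>\<infinity>i\<in>A. ennreal_powr (u i) p) + ennreal d * (\<Sum>\<^sub>\<infinity>i\<in>A. ennreal_powr (v i) p)"
    by (intro infsum_ennreal_lincomb_le le)
  also have "\<dots> < \<infinity>"
    using assms(1,2) unfolding fin by (simp add: ennreal_mult_less_top)
  finally show ?thesis
    by (simp only: fin)
qed

lemma scaled_sup_coeff_le:
  assumes "\<And>k. k < 2 ^ m \<Longrightarrow> \<bar>bump f m k\<bar> \<le> R"
  shows "scaled_sup_coeff f m \<le> R"
proof -
  have "(SUP k\<in>{..<2 ^ m}. \<bar>FS_coeff f (int m) k\<bar>) \<le> 2 powr (real m / 2) * R"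
    using assms by (intro cSUP_least) (auto simp: FS_coeff_eq_bump abs_mult lessThan_empty_iff)
  then have "scaled_sup_coeff f m \<le> 2 powr (- real m / 2) * (2 powr (real m / 2) * R)"
    unfolding scaled_sup_coeff_def by (intro mult_left_mono) auto
  then show ?thesis
    by (simp add: mult.assoc[symmetric] powr_add[symmetric])
qed

lemma bump_lincomb: "bump (\<lambda>x. a * f1 x + b * f2 x) n k = a * bump f1 n k + b * bump f2 n k"
  by (simp add: bump_def algebra_simps)

lemma level_energy_lincomb_powr_le:
  assumes "p > 0" "n \<ge> -1"
  shows "level_energy p (\<lambda>x. a * f1 x + b * f2 x) n powr p \<le>
    (2 * \<bar>a\<bar>) powr p * level_energy p f1 n powr p + (2 * \<bar>b\<bar>) powr p * level_energy p f2 n powr p"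
proof (cases "n = -1")
  case True
  have "FS_coeff (\<lambda>x. a * f1 x + b * f2 x) (-1) 0 = a * FS_coeff f1 (-1) 0 + b * FS_coeff f2 (-1) 0"
    by (simp add: FS_coeff_def algebra_simps)
  then have "\<bar>FS_coeff (\<lambda>x. a * f1 x + b * f2 x) (-1) 0\<bar> powr p \<le>
      (2 * \<bar>a\<bar>) powr p * \<bar>FS_coeff f1 (-1) 0\<bar> powr p + (2 * \<bar>b\<bar>) powr p * \<bar>FS_coeff f2 (-1) 0\<bar> powr p"
    using assms by (simp only: abs_lincomb_powr_le)
  then have "(2 powr (1 - 1 / p)) powr p * \<bar>FS_coeff (\<lambda>x. a * f1 x + b * f2 x) (-1) 0\<bar> powr p \<le>
      (2 powr (1 - 1 / p)) powr p *
      ((2 * \<bar>a\<bar>) powr p * \<bar>FS_coeff f1 (-1) 0\<bar> powr p + (2 * \<bar>b\<bar>) powr p * \<bar>FS_coeff f2 (-1) 0\<bar> powr p)"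
    by (intro mult_left_mono) auto
  then show ?thesis
    using True by (simp add: level_energy_def powr_mult algebra_simps)
next
  case False
  then obtain m where n: "n = int m"
    using assms(2) by (intro that[of "nat n"]) auto
  have "bump_energy p (\<lambda>x. a * f1 x + b * f2 x) m \<le>
      (\<Sum>k<2 ^ m. (2 * \<bar>a\<bar>) powr p * \<bar>bump f1 m k\<bar> powr p + (2 * \<bar>b\<bar>) powr p * \<bar>bump f2 m k\<bar> powr p)"
    unfolding bump_energy_def bump_lincomb using assms by (intro sum_mono abs_lincomb_powr_le) auto
  then show ?thesis
    using assms(1) by (simp add: n level_energy_powr bump_energy_def sum.distrib sum_distrib_left)
qed

lemma tail_seq_lincomb_le:
  "tail_seq (\<lambda>x. a * f1 x + b * f2 x) n \<le> ennreal \<bar>a\<bar> * tail_seq f1 n + ennreal \<bar>b\<bar> * tail_seq f2 n"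
  unfolding tail_seq_def scaled_sup_coeff_def[symmetric]
proof (rule infsum_ennreal_lincomb_le)
  fix m
  have "scaled_sup_coeff (\<lambda>x. a * f1 x + b * f2 x) m \<le> \<bar>a\<bar> * scaled_sup_coeff f1 m + \<bar>b\<bar> * scaled_sup_coeff f2 m"
  proof (rule scaled_sup_coeff_le)
    fix k :: nat assume k: "k < 2 ^ m"
    have "\<bar>bump (\<lambda>x. a * f1 x + b * f2 x) m k\<bar> \<le> \<bar>a\<bar> * \<bar>bump f1 m k\<bar> + \<bar>b\<bar> * \<bar>bump f2 m k\<bar>"
      unfolding bump_lincomb abs_mult[symmetric] by (rule abs_triangle_ineq)
    also have "\<dots> \<le> \<bar>a\<bar> * scaled_sup_coeff f1 m + \<bar>b\<bar> * scaled_sup_coeff f2 m"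
      using k by (intro add_mono mult_left_mono abs_bump_le_scaled_sup_coeff) auto
    finally show "\<bar>bump (\<lambda>x. a * f1 x + b * f2 x) m k\<bar> \<le>
        \<bar>a\<bar> * scaled_sup_coeff f1 m + \<bar>b\<bar> * scaled_sup_coeff f2 m" .
  qed
  then show "ennreal (scaled_sup_coeff (\<lambda>x. a * f1 x + b * f2 x) m) \<le>
      ennreal \<bar>a\<bar> * ennreal (scaled_sup_coeff f1 m) + ennreal \<bar>b\<bar> * ennreal (scaled_sup_coeff f2 m)"
    by (simp add: ennreal_mult[symmetric] ennreal_plus[symmetric] scaled_sup_coeff_nonneg ennreal_leI
        del: ennreal_plus)
qed

lemma energy_space_lincomb:
  assumes "p > 1" "f1 \<in> energy_space p" "f2 \<in> energy_space p"
  shows "(\<lambda>x. a * f1 x + b * f2 x) \<in> energy_space p"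
proof -
  let ?f = "\<lambda>x. a * f1 x + b * f2 x"
  obtain F1 where F1: "F1 \<ge> 0" "energy_norm p f1 \<le> ennreal F1"
    using energy_space_norm[OF assms(2)] by (metis order_refl)
  obtain F2 where F2: "F2 \<ge> 0" "energy_norm p f2 \<le> ennreal F2"
    using energy_space_norm[OF assms(3)] by (metis order_refl)
  note comp1 = energy_norm_components[OF F1(2)] and comp2 = energy_norm_components[OF F2(2)]
  have fin: "x < \<infinity>" if "x \<le> ennreal y" for x y
    using that by (simp add: le_less_trans)
  have "sup_norm ?f \<le> ennreal (\<bar>a\<bar> * F1 + \<bar>b\<bar> * F2)"
    unfolding sup_norm_def
  proof (intro SUP_least ennreal_leI)
    fix x :: real assume x: "x \<in> {0..1}"
    have "\<bar>?f x\<bar> \<le> \<bar>a\<bar> * \<bar>f1 x\<bar> + \<bar>b\<bar> * \<bar>f2 x\<bar>"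
      unfolding abs_mult[symmetric] by (rule abs_triangle_ineq)
    also have "\<dots> \<le> \<bar>a\<bar> * F1 + \<bar>b\<bar> * F2"
      using bounds_of_energy_norm(1)[OF assms(1) F1 x] bounds_of_energy_norm(1)[OF assms(1) F2 x]
      by (intro add_mono mult_left_mono) auto
    finally show "\<bar>?f x\<bar> \<le> \<bar>a\<bar> * F1 + \<bar>b\<bar> * F2" .
  qed
  then have "sup_norm ?f < \<infinity>" by (rule fin)
  moreover have "lp_norm p {-1..} (\<lambda>n. ennreal (level_energy p ?f n)) < \<infinity>"
  proof (rule lp_norm_finite_lincomb[OF fin[OF comp1(2)] fin[OF comp2(2)]])
    fix n :: int assume "n \<in> {-1..}"
    then show "ennreal_powr (ennreal (level_energy p ?f n)) p \<le>
        ennreal ((2 * \<bar>a\<bar>) powr p) * ennreal_powr (ennreal (level_energy p f1 n)) p +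
        ennreal ((2 * \<bar>b\<bar>) powr p) * ennreal_powr (ennreal (level_energy p f2 n)) p"
      using level_energy_lincomb_powr_le[of p n a f1 b f2] assms(1)
      by (simp add: ennreal_powr_ennreal level_energy_nonneg ennreal_mult[symmetric]
          ennreal_plus[symmetric] ennreal_leI del: ennreal_plus)
  qed
  moreover have "lp_norm p UNIV (tail_seq ?f) < \<infinity>"
  proof (rule lp_norm_finite_lincomb[OF fin[OF comp1(3)] fin[OF comp2(3)]])
    fix n
    have "tail_seq f1 n \<le> ennreal F1" "tail_seq f2 n \<le> ennreal F2"
      using assms(1) by (auto intro: le_lp_norm[OF _ F1(1) UNIV_I comp1(3)] le_lp_norm[OF _ F2(1) UNIV_I comp2(3)])
    then obtain x1 x2 where x: "x1 \<ge> 0" "tail_seq f1 n = ennreal x1" "x2 \<ge> 0" "tail_seq f2 n = ennreal x2"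
      by (cases "tail_seq f1 n"; cases "tail_seq f2 n") (auto simp: top_unique)
    \<comment> \<open>Finiteness of both tails matters here: the \<open>p\<close>-th power is then taken of real numbers.\<close>
    have le: "tail_seq ?f n \<le> ennreal (\<bar>a\<bar> * x1 + \<bar>b\<bar> * x2)"
      using tail_seq_lincomb_le[of a f1 b f2 n] x
      by (simp add: ennreal_mult)
    then obtain y where y: "y \<ge> 0" "tail_seq ?f n = ennreal y"
      by (cases "tail_seq ?f n") (auto simp: top_unique)
    have "y \<le> \<bar>a\<bar> * x1 + \<bar>b\<bar> * x2"
      using le x y by (simp del: ennreal_plus)
    then have "y powr p \<le> \<bar>\<bar>a\<bar> * x1 + \<bar>b\<bar> * x2\<bar> powr p"
      using assms(1) y by (intro powr_mono2) auto
    also have "\<dots> \<le> (2 * \<bar>\<bar>a\<bar>\<bar>) powr p * \<bar>x1\<bar> powr p + (2 * \<bar>\<bar>b\<bar>\<bar>) powr p * \<bar>x2\<bar> powr p"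
      using assms(1) by (intro abs_lincomb_powr_le) auto
    finally show "ennreal_powr (tail_seq ?f n) p \<le>
        ennreal ((2 * \<bar>a\<bar>) powr p) * ennreal_powr (tail_seq f1 n) p +
        ennreal ((2 * \<bar>b\<bar>) powr p) * ennreal_powr (tail_seq f2 n) p"
      using x y by (simp add: ennreal_powr_ennreal ennreal_mult[symmetric]
          ennreal_plus[symmetric] ennreal_leI del: ennreal_plus)
  qed
  moreover have "?f \<in> C01"
    using assms(2,3) by (auto simp: energy_space_def C01_def intro!: continuous_intros)
  ultimately show ?thesis
    by (simp add: energy_space_def energy_norm_def)
qed

theorem proposition3p23:
  fixes p q :: real
  assumes "p > 1" and "q > 1" and "1 / p + 1 / q \<ge> 1"
  shows "(\<forall>f\<in>energy_space p. \<forall>g\<in>energy_space q. FS_integral_exists f g \<and> FS_integral f g \<in> C01)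
    \<and> (\<forall>f1\<in>energy_space p. \<forall>f2\<in>energy_space p. \<forall>g\<in>energy_space q. \<forall>a b :: real.
         (\<lambda>x. a * f1 x + b * f2 x) \<in> energy_space p \<and>
         (\<forall>t\<in>{0..1}. FS_integral (\<lambda>x. a * f1 x + b * f2 x) g t
                      = a * FS_integral f1 g t + b * FS_integral f2 g t))
    \<and> (\<forall>f\<in>energy_space p. \<forall>g1\<in>energy_space q. \<forall>g2\<in>energy_space q. \<forall>a b :: real.
         (\<lambda>x. a * g1 x + b * g2 x) \<in> energy_space q \<and>
         (\<forall>t\<in>{0..1}. FS_integral f (\<lambda>x. a * g1 x + b * g2 x) t
                      = a * FS_integral f g1 t + b * FS_integral f g2 t))
    \<and> (\<exists>C::real. C > 0 \<and> (\<forall>f\<in>energy_space p. \<forall>g\<in>energy_space q.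
         sup_norm (FS_integral f g) \<le> ennreal C * energy_norm p f * energy_norm q g))"
proof (intro conjI ballI allI)
  note FS = is_FS_integral_of_energy_space[OF assms]
  show "FS_integral_exists f g" "FS_integral f g \<in> C01"
    if "f \<in> energy_space p" "g \<in> energy_space q" for f g
    using FS[OF that] by (auto simp: FS_integral_exists_def is_FS_integral_def)
  show lin1: "(\<lambda>x. a * f1 x + b * f2 x) \<in> energy_space p"
    if "f1 \<in> energy_space p" "f2 \<in> energy_space p" for f1 f2 a b
    using assms(1) that by (rule energy_space_lincomb)
  show lin2: "(\<lambda>x. a * g1 x + b * g2 x) \<in> energy_space q"
    if "g1 \<in> energy_space q" "g2 \<in> energy_space q" for g1 g2 a b
    using assms(2) that by (rule energy_space_lincomb)
  show "FS_integral (\<lambda>x. a * f1 x + b * f2 x) g t = a * FS_integral f1 g t + b * FS_integral f2 g t"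
    if "f1 \<in> energy_space p" "f2 \<in> energy_space p" "g \<in> energy_space q" "t \<in> {0..1}" for f1 f2 g a b t
    using is_FS_integral_unique[OF FS[OF lin1[OF that(1,2)] that(3)]
        is_FS_integral_lincomb[OF FS[OF that(1,3)] FS[OF that(2,3)] left_sum_lincomb_left] that(4)] .
  show "FS_integral f (\<lambda>x. a * g1 x + b * g2 x) t = a * FS_integral f g1 t + b * FS_integral f g2 t"
    if "f \<in> energy_space p" "g1 \<in> energy_space q" "g2 \<in> energy_space q" "t \<in> {0..1}" for f g1 g2 a b t
    using is_FS_integral_unique[OF FS[OF that(1) lin2[OF that(2,3)]]
        is_FS_integral_lincomb[OF FS[OF that(1,2)] FS[OF that(1,3)] left_sum_lincomb_right] that(4)] .
  \<comment> \<open>The summand 12 also makes the constant positive.\<close>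
  let ?C = "2 * energy_factor p * energy_factor q + 12"
  have C: "?C > 0"
    by (simp add: energy_factor_def add_nonneg_pos)
  have "sup_norm (FS_integral f g) \<le> ennreal ?C * energy_norm p f * energy_norm q g"
    if fg: "f \<in> energy_space p" "g \<in> energy_space q" for f g
  proof -
    obtain F G where FG: "F \<ge> 0" "energy_norm p f = ennreal F" "G \<ge> 0" "energy_norm q g = ennreal G"
      using fg energy_space_norm by metis
    have "continuous_on {0..1} g"
      using fg by (simp add: energy_space_def C01_def)
    then obtain J where J: "is_FS_integral f g J" "\<forall>t\<in>{0..1}. \<bar>J t\<bar> \<le> ?C * F * G"
      using ex_FS_integral_bounded[OF assms, of F f g G] FG by auto
    have "sup_norm (FS_integral f g) \<le> ennreal (?C * F * G)"
      unfolding sup_norm_def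
      using J is_FS_integral_unique[OF FS[OF fg] J(1)] by (intro SUP_least ennreal_leI) simp
    also have "\<dots> = ennreal ?C * energy_norm p f * energy_norm q g"
      using FG C by (simp add: ennreal_mult)
    finally show ?thesis .
  qed
  then show "\<exists>C::real. C > 0 \<and> (\<forall>f\<in>energy_space p. \<forall>g\<in>energy_space q.
         sup_norm (FS_integral f g) \<le> ennreal C * energy_norm p f * energy_norm q g)"
    using C by blast
qed

end
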